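(* (Without-jamming lower bound.) Let $0<\alpha<1$, $0<\eta<1$, $\beta=\frac{1-\alpha}{2\eta\alpha}$, and $P_1,P_2,N_0,\mu_1,\mu_2>0$. Let $X,Y$ be independent exponential random variables with means $\mu_1,\mu_2$. Put $\bar\gamma_1=P_1\mu_1$, $\bar\gamma_2=P_2\mu_2$ and assume $\bar\gamma_1\ne\bar\gamma_2$. Define $$\gamma_{R}=\frac{P_1X+P_2Y}{N_0},\qquad \gamma_{S_2}=\frac{P_1XY}{N_0Y+N_0\beta},\qquad \gamma_{S_1}=\frac{P_2XY}{N_0X+N_0\beta},$$ $$\bar R_{Act}^{WoJ}=\mathbb E\left\{\left[\frac{1-\alpha}{2}\log_2\frac{(1+\gamma_{S_1})(1+\gamma_{S_2})}{1+\gamma_R}\right]^+\right\}.$$ Then $$\bar R_{Act}^{WoJ}\ \ge\ \bar R_{LB}^{WoJ}:=\frac{1-\alpha}{2\ln 2}\left[\widehat I_1+\widehat I_2-I_3\right]^+,$$ where $$\widehat I_1=\ln\left[1+\exp\left(-2\Phi+\ln\frac{\bar\gamma_1\mu_2}{\beta N_0}+e^{\beta/\mu_2}\,\mathrm{Ei}\!\left(-\frac{\beta}{\mu_2}\right)\right)\right],$$ $$\widehat I_2=\ln\left[1+\exp\left(-2\Phi+\ln\frac{\bar\gamma_2\mu_1}{\beta N_0}+e^{\beta/\mu_1}\,\mathrm{Ei}\!\left(-\frac{\beta}{\mu_1}\right)\right)\right],$$ $$I_3=\frac{\bar\gamma_1}{\bar\gamma_2-\bar\gamma_1}e^{N_0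/\bar\gamma_1}\,\mathrm{Ei}\!\left(-\frac{N_0}{\bar\gamma_1}\right)+\frac{\bar\gamma_2}{\bar\gamma_1-\bar\gamma_2}e^{N_0/\bar\gamma_2}\,\mathrm{Ei}\!\left(-\frac{N_0}{\bar\gamma_2}\right).$$
   Context: $[x]^+=\max(x,0)$. $\Phi\approx0.577215$ is Euler's constant. $\mathrm{Ei}(x)=-\int_{-x}^{\infty}\frac{e^{-t}}{t}\,dt$ for $x<0$ is the exponential integral. In the model, $X$ and $Y$ are the channel power gains between an untrusted amplify-and-forward relay and the sources $1$ and $2$; $P_i$ are the source transmit powers, $N_0$ the noise power, $\alpha$ the time-switching ratio, $\eta$ the energy conversion efficiency. $\gamma_{S_1},\gamma_{S_2},\gamma_R$ are the SNRs at the two sources and at the relay (under the high-SNR convention), and $\bar R_{Act}^{WoJ}$ is the ergodic secrecy sum rate without jamming when the relay is active. *)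

theory Defs
  imports "HOL-Probability.Probability"
begin

text \<open>The exponential integral on the negative half-line; only meaningful for \<open>x < 0\<close>.\<close>

definition Ei :: "real \<Rightarrow> real" where
  "Ei x = - (LBINT t:{-x..}. exp (- t) / t)"

definition pos_part :: "real \<Rightarrow> real" where
  "pos_part x = max x 0"

text \<open>Arguments \<open>x\<close> and \<open>y\<close> are the channel power gains between the relay and sources 1 and 2;
  \<open>snr_S1\<close> and \<open>snr_S2\<close> follow the high-SNR convention.\<close>

definition snr_R :: "real \<Rightarrow> real \<Rightarrow> real \<Rightarrow> real \<Rightarrow> real \<Rightarrow> real" where
  "snr_R P1 P2 N0 x y = (P1 * x + P2 * y) / N0"

definition snr_S2 :: "real \<Rightarrow> real \<Rightarrow> real \<Rightarrow> real \<Rightarrow> real \<Rightarrow> real" where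
  "snr_S2 P1 N0 \<beta> x y = P1 * x * y / (N0 * y + N0 * \<beta>)"

definition snr_S1 :: "real \<Rightarrow> real \<Rightarrow> real \<Rightarrow> real \<Rightarrow> real \<Rightarrow> real" where
  "snr_S1 P2 N0 \<beta> x y = P2 * x * y / (N0 * x + N0 * \<beta>)"

definition R_Act_WoJ ::
  "'a measure \<Rightarrow> ('a \<Rightarrow> real) \<Rightarrow> ('a \<Rightarrow> real) \<Rightarrow>
    real \<Rightarrow> real \<Rightarrow> real \<Rightarrow> real \<Rightarrow> real \<Rightarrow> real" where
  "R_Act_WoJ M X Y \<alpha> \<beta> P1 P2 N0 =
    prob_space.expectation M (\<lambda>\<omega>. pos_part ((1 - \<alpha>) / 2 *
      log 2 ((1 + snr_S1 P2 N0 \<beta> (X \<omega>) (Y \<omega>)) * (1 + snr_S2 P1 N0 \<beta> (X \<omega>) (Y \<omega>))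
             / (1 + snr_R P1 P2 N0 (X \<omega>) (Y \<omega>)))))"

text \<open>The two terms of the bound belonging to the sources have the same shape: the first is
  \<open>I_hat N0 \<beta> \<gamma>1 \<mu>2\<close>, the second \<open>I_hat N0 \<beta> \<gamma>2 \<mu>1\<close>, where \<open>\<gamma>i = Pi * \<mu>i\<close>.\<close>

definition I_hat :: "real \<Rightarrow> real \<Rightarrow> real \<Rightarrow> real \<Rightarrow> real" where
  "I_hat N0 \<beta> \<gamma> \<mu> =
    ln (1 + exp (- 2 * euler_mascheroni + ln (\<gamma> * \<mu> / (\<beta> * N0))
                 + exp (\<beta> / \<mu>) * Ei (- \<beta> / \<mu>)))"

definition I_3 :: "real \<Rightarrow> real \<Rightarrow> real \<Rightarrow> real" where
  "I_3 N0 \<gamma>1 \<gamma>2 =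
    \<gamma>1 / (\<gamma>2 - \<gamma>1) * exp (N0 / \<gamma>1) * Ei (- N0 / \<gamma>1)
    + \<gamma>2 / (\<gamma>1 - \<gamma>2) * exp (N0 / \<gamma>2) * Ei (- N0 / \<gamma>2)"

definition R_LB_WoJ ::
  "real \<Rightarrow> real \<Rightarrow> real \<Rightarrow> real \<Rightarrow> real \<Rightarrow> real \<Rightarrow> real \<Rightarrow> real" where
  "R_LB_WoJ \<alpha> \<beta> N0 \<mu>1 \<mu>2 \<gamma>1 \<gamma>2 =
    (1 - \<alpha>) / (2 * ln 2) *
      pos_part (I_hat N0 \<beta> \<gamma>1 \<mu>2 + I_hat N0 \<beta> \<gamma>2 \<mu>1 - I_3 N0 \<gamma>1 \<gamma>2)"

end

theory Submission
  imports Defs "HOL-Real_Asymp.Real_Asymp"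
begin

text \<open>Both the positive part and \<open>w \<mapsto> ln (1 + exp w)\<close> are convex. Jensen's inequality for the first
  moves the expectation inside the positive part; for the second, with \<open>w\<close> the logarithm of a source
  SNR, it leaves the means of \<open>ln X\<close>, \<open>ln Y\<close> and \<open>ln (Y + \<beta>)\<close>, which give \<open>I_hat\<close>. The relay term is
  computed exactly: the density of a sum of two independent exponentials with distinct rates is a
  linear combination of the two exponential densities, so the mean of \<open>ln (1 + \<gamma>\<^sub>R)\<close> is the same
  combination of two one-variable means.\<close>

section \<open>Scaling, positivity and integrability of exponential variables\<close>

lemma (in prob_space) exponential_distributed_scale:
  assumes "distributed M lborel X (exponential_density l)" "0 < l" "0 < c"
  shows "distributed M lborel (\<lambda>\<omega>. c * X \<omega>) (exponential_density (l / c))"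
proof -
  have X: "X \<in> borel_measurable M" "\<forall>a\<ge>0. \<P>(\<omega> in M. X \<omega> \<le> a) = 1 - exp (- a * l)"
    using exponential_distributed_iff[OF \<open>0 < l\<close>, of X] assms(1) by auto
  have "\<P>(\<omega> in M. c * X \<omega> \<le> a) = 1 - exp (- a * (l / c))" if "a \<ge> 0" for a
  proof -
    have "(c * X \<omega> \<le> a) = (X \<omega> \<le> a / c)" for \<omega>
      using \<open>0 < c\<close> by (simp add: field_simps)
    moreover have "\<P>(\<omega> in M. X \<omega> \<le> a / c) = 1 - exp (- (a / c) * l)"
      using X(2) that \<open>0 < c\<close> by simp
    ultimately show ?thesis by simp
  qed
  then show ?thesis
    using X(1) assms(2,3) by (subst exponential_distributed_iff) auto
qed

lemma (in prob_space) exponential_distributed_AE_pos: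
  assumes "distributed M lborel X (exponential_density l)" "0 < l"
  shows "AE \<omega> in M. 0 < X \<omega>"
proof -
  have X[measurable]: "X \<in> borel_measurable M" and "\<forall>a\<ge>0. \<P>(\<omega> in M. X \<omega> \<le> a) = 1 - exp (- a * l)"
    using exponential_distributed_iff[OF \<open>0 < l\<close>, of X] assms(1) by auto
  then have "\<P>(\<omega> in M. X \<omega> \<le> 0) = 0" by force
  then have "AE \<omega> in M. \<not> X \<omega> \<le> 0"
    by (subst (asm) prob_eq_0) (auto simp: pred_def)
  then show ?thesis by (simp add: not_le)
qed

lemma (in prob_space) exponential_distributed_integrable:
  assumes "distributed M lborel X (exponential_density l)" "0 < l"
  shows "integrable M X"
  \<comment> \<open>An exponential variable is Erlang with shape parameter 0; the 1 selects its
    first moment.\<close>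
  using erlang_ith_moment_integrable[of l X 0 1] assms by simp

section \<open>Power moments and the mean of the logarithm\<close>

text \<open>For rate 1 the moment is literally Euler's integral for \<open>Gamma\<close>. The
  exponent -1/2 serves to dominate \<open>ln\<close> near 0, and exponents in (-1, 0) give the
  difference quotients of \<open>Gamma\<close> at 1.\<close>

lemma (in prob_space) exponential_distributed_powr:
  assumes D: "distributed M lborel X (exponential_density 1)" and "0 < s"
  shows "has_bochner_integral M (\<lambda>\<omega>. X \<omega> powr (s - 1)) (Gamma s)"
proof (rule has_bochner_integral_nn_integral)
  have X[measurable]: "X \<in> borel_measurable M"
    using distributed_measurable[OF D] by simp
  show "(\<lambda>\<omega>. X \<omega> powr (s - 1)) \<in> borel_measurable M" by measurable
  have "(\<integral>\<^sup>+ \<omega>. ennreal (X \<omega> powr (s - 1)) \<partial>M)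
      = (\<integral>\<^sup>+ x. ennreal (exponential_density 1 x) * ennreal (x powr (s - 1)) \<partial>lborel)"
    by (rule distributed_nn_integral[OF D, symmetric]) simp
  also have "\<dots> = (\<integral>\<^sup>+ t. ennreal (indicator {0..} t * t powr (s - 1) / exp t) \<partial>lborel)"
    by (intro nn_integral_cong)
       (auto simp: exponential_density_def ennreal_mult'[symmetric] exp_minus divide_simps
         split: split_indicator)
  finally show "(\<integral>\<^sup>+ \<omega>. ennreal (X \<omega> powr (s - 1)) \<partial>M) = ennreal (Gamma s)"
    using Gamma_conv_nn_integral_real[OF \<open>0 < s\<close>] by simp
qed (use \<open>0 < s\<close> Gamma_real_pos[of s] in auto)

text \<open>The inequality \<open>ln x \<le> x - 1\<close> is used twice: at \<open>X\<close> it
  controls large values, and at \<open>X powr (-1/2)\<close>, whose logarithm is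
  \<open>- ln X / 2\<close>, it controls values near 0.\<close>

lemma (in prob_space) exponential_distributed_integrable_ln:
  assumes D: "distributed M lborel X (exponential_density 1)"
  shows "integrable M (\<lambda>\<omega>. ln (X \<omega>))"
proof (rule Bochner_Integration.integrable_bound)
  have X[measurable]: "X \<in> borel_measurable M"
    using distributed_measurable[OF D] by simp
  show "(\<lambda>\<omega>. ln (X \<omega>)) \<in> borel_measurable M" by measurable
  show "integrable M (\<lambda>\<omega>. X \<omega> + 2 * X \<omega> powr (1 / 2 - 1))"
    using exponential_distributed_powr[OF D, of "1/2"] exponential_distributed_integrable[OF D]
    by (auto simp: has_bochner_integral_iff)
  show "AE \<omega> in M. norm (ln (X \<omega>)) \<le> norm (X \<omega> + 2 * X \<omega> powr (1 / 2 - 1))"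
    using exponential_distributed_AE_pos[OF D zero_less_one]
  proof eventually_elim
    case (elim \<omega>)
    have "ln (X \<omega>) \<le> X \<omega> - 1" using elim by (rule ln_le_minus_one)
    moreover have "ln (X \<omega> powr (1 / 2 - 1)) \<le> X \<omega> powr (1 / 2 - 1) - 1"
      using elim by (intro ln_le_minus_one) simp
    moreover have "ln (X \<omega> powr (1 / 2 - 1)) = - ln (X \<omega>) / 2"
      using elim by (simp add: ln_powr)
    moreover have "X \<omega> powr (1 / 2 - 1) > 0" using elim by simp
    ultimately have "\<bar>ln (X \<omega>)\<bar> \<le> X \<omega> + 2 * X \<omega> powr (1 / 2 - 1)"
      using elim by linarith
    then show ?case by simp
  qed
qed

text \<open>For \<open>s < 0\<close> the bound \<open>x powr s \<ge> 1 + s * ln x\<close> gives \<open>ln x \<ge> (x powr s - 1) / s\<close>; the mean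
  of the right-hand side is a difference quotient of \<open>Gamma\<close> at \<open>1\<close>, so no differentiation under
  the integral is needed.\<close>

lemma (in prob_space) exponential_distributed_expectation_ln_ge:
  assumes D: "distributed M lborel X (exponential_density 1)"
  shows "- euler_mascheroni \<le> expectation (\<lambda>\<omega>. ln (X \<omega>))"
proof -
  have bound: "(Gamma (1 + s) - Gamma 1) / s \<le> expectation (\<lambda>\<omega>. ln (X \<omega>))"
    if s: "s < 0" "- 1 < s" for s :: real
  proof -
    have hb: "has_bochner_integral M (\<lambda>\<omega>. X \<omega> powr s) (Gamma (1 + s))"
      using exponential_distributed_powr[OF D, of "1 + s"] s by simp
    have "(Gamma (1 + s) - Gamma 1) / s = expectation (\<lambda>\<omega>. (X \<omega> powr s - 1) / s)"
      using hb by (simp add: has_bochner_integral_iff prob_space)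
    also have "\<dots> \<le> expectation (\<lambda>\<omega>. ln (X \<omega>))"
    proof (rule integral_mono_AE)
      show "integrable M (\<lambda>\<omega>. (X \<omega> powr s - 1) / s)"
        using hb by (simp add: has_bochner_integral_iff)
      show "integrable M (\<lambda>\<omega>. ln (X \<omega>))"
        by (rule exponential_distributed_integrable_ln[OF D])
      show "AE \<omega> in M. (X \<omega> powr s - 1) / s \<le> ln (X \<omega>)"
        using exponential_distributed_AE_pos[OF D zero_less_one]
      proof eventually_elim
        case (elim \<omega>)
        have "1 + s * ln (X \<omega>) \<le> X \<omega> powr s"
          using elim by (simp add: powr_def)
        \<comment> \<open>Division by the negative \<open>s\<close> reverses the inequality and so
          yields a lower bound for \<open>ln\<close>.\<close>
        then show ?case using s by (simp add: divide_simps mult.commute)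
      qed
    qed
    finally show ?thesis .
  qed
  \<comment> \<open>\<open>Gamma 1 = 1\<close> and \<open>Digamma 1 = - euler_mascheroni\<close>;
    this is where Euler's constant enters.\<close>
  have "(Gamma has_field_derivative Gamma 1 * Digamma 1) (at (1::real))"
    by (rule has_field_derivative_Gamma) simp
  then have "((\<lambda>s. (Gamma (1 + s) - Gamma 1) / s) \<longlongrightarrow> - euler_mascheroni) (at (0::real))"
    by (simp add: DERIV_def)
  \<comment> \<open>The bound holds for \<open>-1 < s < 0\<close> only, so the limit is taken from
    the left.\<close>
  then have "((\<lambda>s. (Gamma (1 + s) - Gamma 1) / s) \<longlongrightarrow> - euler_mascheroni) (at_left (0::real))"
    by (rule tendsto_mono[OF at_le, rotated]) simp
  moreover have "\<forall>\<^sub>F s in at_left (0::real). (Gamma (1 + s) - Gamma 1) / s \<le> expectation (\<lambda>\<omega>. ln (X \<omega>))"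
    using eventually_at_left_field[of _ "0::real"] bound by (auto intro!: exI[of _ "-1"])
  ultimately show ?thesis
    by (intro tendsto_upperbound) auto
qed

section \<open>The mean of \<open>ln (1 + X / c)\<close> and the exponential integral\<close>

lemma norm_ln_one_plus_le:
  fixes x :: real
  assumes "0 < x"
  shows "norm (ln (1 + x)) \<le> norm x"
  using assms by (simp add: ln_add_one_self_le_self)

text \<open>Substitute \<open>t = c * l + l * x\<close> in the integral that defines
  \<open>Ei\<close>: the half-line from \<open>c * l\<close> becomes the one from 0, and the
  constant factor \<open>exp (- (c * l))\<close> comes out.\<close>

lemma exp_integral_shift:
  fixes c l :: real
  assumes "0 < c" "0 < l"
  shows "(LBINT x:{0..}. exp (- l * x) / (c + x)) = - exp (c * l) * Ei (- (c * l))"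
proof -
  have "- Ei (- (c * l)) = (\<integral>t. indicator {c * l..} t *\<^sub>R (exp (- t) / t) \<partial>lborel)"
    by (simp add: Ei_def set_lebesgue_integral_def)
  also have "\<dots> = \<bar>l\<bar> *\<^sub>R (\<integral>x. indicator {c * l..} (c * l + l * x) *\<^sub>R
      (exp (- (c * l + l * x)) / (c * l + l * x)) \<partial>lborel)"
    using \<open>0 < l\<close> by (intro lborel_integral_real_affine) simp
  also have "\<dots> = (\<integral>x. exp (- (c * l)) * (indicator {0..} x *\<^sub>R (exp (- l * x) / (c + x))) \<partial>lborel)"
    unfolding integral_scaleR_right[symmetric]
  proof (intro Bochner_Integration.integral_cong refl)
    fix x :: real
    have "exp (- (c * l + l * x)) = exp (- (c * l)) * exp (- l * x)"
      by (simp add: exp_add[symmetric])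
    moreover have "c * l + l * x = l * (c + x)" by (simp add: algebra_simps)
    ultimately show "\<bar>l\<bar> *\<^sub>R indicator {c * l..} (c * l + l * x) *\<^sub>R
        (exp (- (c * l + l * x)) / (c * l + l * x)) =
        exp (- (c * l)) * (indicator {0..} x *\<^sub>R (exp (- l * x) / (c + x)))"
      using assms by (auto simp: indicator_def zero_le_mult_iff)
  qed
  also have "\<dots> = exp (- (c * l)) * (LBINT x:{0..}. exp (- l * x) / (c + x))"
    unfolding set_lebesgue_integral_def by (rule integral_mult_right_zero)
  finally show ?thesis
    by (simp add: exp_minus field_simps)
qed

text \<open>For rate \<open>l\<close>, integration by parts turns the mean of a function vanishing
  at 0 into the mean of its derivative divided by \<open>l\<close>. Here this replaces the logarithm
  by \<open>1 / (l * (c + X))\<close>, whose mean is the integral of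
  \<open>exp_integral_shift\<close>.\<close>

lemma (in prob_space) exponential_distributed_ln_add:
  assumes D: "distributed M lborel X (exponential_density l)" and "0 < l" "0 < c"
  shows "integrable M (\<lambda>\<omega>. ln (1 + X \<omega> / c))" (is ?int)
    and "expectation (\<lambda>\<omega>. ln (1 + X \<omega> / c)) = - exp (c * l) * Ei (- (c * l))" (is ?exp)
proof -
  note nonneg = exponential_density_nonneg[OF \<open>0 < l\<close>]
  have X[measurable]: "X \<in> borel_measurable M"
    using distributed_measurable[OF D] by simp
  have pos: "AE \<omega> in M. 0 < X \<omega>"
    by (rule exponential_distributed_AE_pos[OF D \<open>0 < l\<close>])
  show int: ?int
  proof (rule Bochner_Integration.integrable_bound)
    show "integrable M (\<lambda>\<omega>. X \<omega> / c)"
      using exponential_distributed_integrable[OF D \<open>0 < l\<close>] by simp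
    show "AE \<omega> in M. norm (ln (1 + X \<omega> / c)) \<le> norm (X \<omega> / c)"
      using pos by eventually_elim (use \<open>0 < c\<close> in \<open>simp add: norm_ln_one_plus_le del: real_norm_def\<close>)
  qed simp
  have int': "integrable M (\<lambda>\<omega>. 1 / (l * (c + X \<omega>)))"
  proof (rule integrable_const_bound)
    show "AE \<omega> in M. norm (1 / (l * (c + X \<omega>))) \<le> 1 / (l * c)"
      using pos
      by eventually_elim (use \<open>0 < c\<close> \<open>0 < l\<close> in \<open>auto simp: abs_mult intro!: divide_left_mono mult_left_mono\<close>)
  qed simp
  \<comment> \<open>Integration by parts: \<open>f\<close> is the derivative of \<open>F\<close>, which vanishes at \<open>0\<close> and at infinity.\<close>
  define f where "f y = l * exp (- l * y) * ln (1 + y / c) - exp (- l * y) / (c + y)" for y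
  define F where "F y = - (exp (- l * y) * ln (1 + y / c))" for y
  \<comment> \<open>The density is \<open>l\<close> at 0, whereas the fundamental theorem below
    works on the open half-line; the two integrands differ at this single point.\<close>
  have AE0: "AE y in lborel. y \<noteq> (0::real)" by (rule AE_lborel_singleton)
  have density_f: "AE y in lborel. exponential_density l y * (ln (1 + y / c) - 1 / (l * (c + y)))
      = indicator {0<..} y *\<^sub>R f y"
    using AE0
    by eventually_elim
       (use \<open>0 < l\<close> in \<open>auto simp: f_def exponential_density_def right_diff_distrib mult_ac split: split_indicator\<close>)
  have meas: "(\<lambda>y. ln (1 + y / c) - 1 / (l * (c + y))) \<in> borel_measurable lborel"
    by simp
  \<comment> \<open>Integrability of \<open>f\<close> is not estimated directly: it is transferred
    from that of the two random variables.\<close>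
  have "integrable lborel (\<lambda>y. exponential_density l y * (ln (1 + y / c) - 1 / (l * (c + y))))"
    using int int' by (subst distributed_integrable[OF D meas]) (auto simp: nonneg)
  then have "integrable lborel (\<lambda>y. indicator {0<..} y *\<^sub>R f y)"
    by (subst (asm) integrable_cong_AE[OF _ _ density_f]) (auto simp: f_def)
  moreover have ei: "einterval 0 \<infinity> = {0::real<..}"
    by (auto simp: einterval_def zero_ereal_def)
  ultimately have si: "set_integrable lborel (einterval 0 \<infinity>) f"
    by (simp add: set_integrable_def)
  have "(LBINT y=0..\<infinity>. f y) = 0 - 0"
  proof (rule interval_integral_FTC_integrable)
    fix y :: real assume "0 < ereal y"
    then have y: "0 < y" by simp
    have "(F has_real_derivative f y) (at y)"
      unfolding F_def f_def using y \<open>0 < c\<close>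
      by (auto intro!: derivative_eq_intros simp: divide_simps add_pos_pos)
    then show "(F has_vector_derivative f y) (at y)"
      by (simp add: has_real_derivative_iff_has_vector_derivative)
    show "isCont f y"
      unfolding f_def using y \<open>0 < c\<close> by (auto intro!: continuous_intros simp: add_pos_pos add_nonneg_eq_0_iff)
  next
    have "isCont F 0"
      unfolding F_def using \<open>0 < c\<close> by (auto intro!: continuous_intros)
    then have "(F \<longlongrightarrow> 0) (at 0)" by (simp add: isCont_def F_def)
    then have "(F \<longlongrightarrow> 0) (at_right 0)"
      by (rule tendsto_mono[OF at_le, rotated]) simp
    then show "((F \<circ> real_of_ereal) \<longlongrightarrow> 0) (at_right 0)"
      unfolding zero_ereal_def by (simp only: ereal_tendsto_simps1)
    have "(F \<longlongrightarrow> 0) at_top"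
      unfolding F_def using \<open>0 < c\<close> \<open>0 < l\<close> by real_asymp
    then show "((F \<circ> real_of_ereal) \<longlongrightarrow> 0) (at_left \<infinity>)"
      by (simp only: ereal_tendsto_simps1)
  qed (use si in auto)
  then have "(\<integral>y. indicator {0<..} y *\<^sub>R f y \<partial>lborel) = 0"
    by (simp add: interval_lebesgue_integral_def set_lebesgue_integral_def ei)
  then have "(\<integral>y. exponential_density l y * (ln (1 + y / c) - 1 / (l * (c + y))) \<partial>lborel) = 0"
    by (subst integral_cong_AE[OF _ _ density_f]) (auto simp: f_def)
  then have "expectation (\<lambda>\<omega>. ln (1 + X \<omega> / c) - 1 / (l * (c + X \<omega>))) = 0"
    by (subst (asm) distributed_integral[OF D meas]) (auto simp: nonneg)
  then have "expectation (\<lambda>\<omega>. ln (1 + X \<omega> / c)) = expectation (\<lambda>\<omega>. 1 / (l * (c + X \<omega>)))"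
    using int int' by simp
  also have "\<dots> = (\<integral>y. exponential_density l y * (1 / (l * (c + y))) \<partial>lborel)"
    by (rule distributed_integral[OF D, symmetric]) (auto simp: nonneg)
  also have "\<dots> = (LBINT y:{0..}. exp (- l * y) / (c + y))"
    unfolding set_lebesgue_integral_def
    using \<open>0 < l\<close> by (intro Bochner_Integration.integral_cong)
      (auto simp: exponential_density_def mult_ac split: split_indicator)
  finally show ?exp
    using exp_integral_shift[OF \<open>0 < c\<close> \<open>0 < l\<close>] by simp
qed

section \<open>The sum of two independent exponentials with distinct rates\<close>

text \<open>The product of the densities lives on \<open>0 \<le> y \<le> z\<close> and is there a
  constant times \<open>exp ((l - k) * y)\<close>, which has an elementary antiderivative because
  \<open>l \<noteq> k\<close>. The weights \<open>k / (k - l)\<close> and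
  \<open>- l / (k - l)\<close> of the result add up to 1, and one of them is negative.\<close>

lemma convolution_exponential_density:
  fixes l k :: real
  assumes "0 < l" "0 < k" "l \<noteq> k"
  shows "(\<integral>\<^sup>+y. ennreal (exponential_density l (z - y)) * ennreal (exponential_density k y) \<partial>lborel)
    = ennreal ((k * exponential_density l z - l * exponential_density k z) / (k - l))"
proof (cases "z < 0")
  case True
  then have "(\<integral>\<^sup>+y. ennreal (exponential_density l (z - y)) * ennreal (exponential_density k y) \<partial>lborel)
    = (\<integral>\<^sup>+(y::real). 0 \<partial>lborel)"
    by (intro nn_integral_cong) (auto simp: exponential_density_def)
  then show ?thesis
    using True by (simp add: exponential_density_def)
next
  case False
  define f where "f y = l * k * exp (- (l * z)) * exp ((l - k) * y)" for y
  define F where "F y = l * k / (l - k) * exp (- (l * z)) * exp ((l - k) * y)" for y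
  have "(\<integral>\<^sup>+y. ennreal (exponential_density l (z - y)) * ennreal (exponential_density k y) \<partial>lborel)
    = (\<integral>\<^sup>+y. ennreal (f y) * indicator {0..z} y \<partial>lborel)"
    using assms
    by (intro nn_integral_cong)
       (auto simp: exponential_density_def f_def ennreal_mult'[symmetric] exp_add[symmetric]
          exp_diff exp_minus field_simps split: split_indicator)
  also have "\<dots> = ennreal (F z - F 0)"
  proof (rule nn_integral_FTC_Icc)
    show "f \<in> borel_measurable borel" unfolding f_def by measurable
    show "DERIV F y :> f y" for y
      unfolding F_def f_def
      using assms by (auto intro!: derivative_eq_intros)
  qed (use assms False in \<open>auto simp: f_def\<close>)
  also have "F z - F 0 = (k * exponential_density l z - l * exponential_density k z) / (k - l)"
  proof -
    have "exp (- (l * z)) * exp ((l - k) * z) = exp (- (k * z))"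
      by (simp add: exp_add[symmetric] algebra_simps)
    then have "F z = l * k / (l - k) * exp (- (k * z))"
      unfolding F_def by (simp only: mult.assoc)
    moreover have "l * k / (l - k) * A - l * k / (l - k) * B = (k * (l * B) - l * (k * A)) / (k - l)" for A B
      using \<open>l \<noteq> k\<close> by (simp add: divide_simps) (simp add: algebra_simps)
    moreover have "F 0 = l * k / (l - k) * exp (- (l * z))"
      by (simp add: F_def)
    moreover have "exponential_density l z = l * exp (- (l * z))"
        "exponential_density k z = k * exp (- (k * z))"
      using False by (simp_all add: exponential_density_def mult.commute)
    ultimately show ?thesis by simp
  qed
  finally show ?thesis .
qed

text \<open>The expectation is linear in the density, so the signed combination of densities from
  \<open>convolution_exponential_density\<close> carries over to means. It is applied to
  \<open>g z = ln (1 + z / N0)\<close>.\<close>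

lemma (in prob_space) exponential_distributed_sum_expectation:
  assumes DX: "distributed M lborel X (exponential_density l)" and "0 < l"
    and DY: "distributed M lborel Y (exponential_density k)" and "0 < k"
    and "l \<noteq> k" and indep: "indep_var borel X borel Y"
    and g[measurable]: "g \<in> borel_measurable borel"
    and gX: "integrable M (\<lambda>\<omega>. g (X \<omega>))" and gY: "integrable M (\<lambda>\<omega>. g (Y \<omega>))"
  shows "expectation (\<lambda>\<omega>. g (X \<omega> + Y \<omega>) :: real)
    = (k * expectation (\<lambda>\<omega>. g (X \<omega>)) - l * expectation (\<lambda>\<omega>. g (Y \<omega>))) / (k - l)"
proof -
  define h where "h z = (k * exponential_density l z - l * exponential_density k z) / (k - l)" for z
  have D: "distributed M lborel (\<lambda>\<omega>. X \<omega> + Y \<omega>) (\<lambda>z. ennreal (h z))"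
    using distributed_convolution[OF indep DX DY] convolution_exponential_density assms(2,4,5)
    by (simp add: h_def)
  \<comment> \<open>With one negative weight this is not immediate:
    \<open>exp (- (l * z)) - exp (- (k * z))\<close> has the sign of \<open>k - l\<close> for
    \<open>z \<ge> 0\<close>.\<close>
  have h_nonneg: "0 \<le> h z" for z
  proof (cases "z < 0")
    case False
    have "0 \<le> (exp (- (l * z)) - exp (- (k * z))) / (k - l)"
      using False \<open>l \<noteq> k\<close>
      by (cases "l < k") (auto simp: zero_le_divide_iff mult_right_mono)
    then have "0 \<le> l * k * ((exp (- (l * z)) - exp (- (k * z))) / (k - l))"
      using assms(2,4) by (intro mult_nonneg_nonneg) auto
    also have "\<dots> = h z"
      using False by (simp add: h_def exponential_density_def algebra_simps diff_divide_distrib)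
    finally show ?thesis .
  qed (simp add: h_def exponential_density_def)
  note nonneg = exponential_density_nonneg[OF \<open>0 < l\<close>] exponential_density_nonneg[OF \<open>0 < k\<close>]
  have iX: "integrable lborel (\<lambda>z. exponential_density l z * g z)"
    using gX by (subst distributed_integrable[OF DX]) (auto simp: nonneg)
  have iY: "integrable lborel (\<lambda>z. exponential_density k z * g z)"
    using gY by (subst distributed_integrable[OF DY]) (auto simp: nonneg)
  have "expectation (\<lambda>\<omega>. g (X \<omega> + Y \<omega>)) = (\<integral>z. h z * g z \<partial>lborel)"
    by (rule distributed_integral[OF D, symmetric]) (auto simp: h_nonneg)
  also have "\<dots> = (\<integral>z. (k * (exponential_density l z * g z) - l * (exponential_density k z * g z)) / (k - l) \<partial>lborel)"
    by (simp add: h_def algebra_simps diff_divide_distrib)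
  also have "\<dots> = (k * (\<integral>z. exponential_density l z * g z \<partial>lborel)
      - l * (\<integral>z. exponential_density k z * g z \<partial>lborel)) / (k - l)"
    using iX iY by simp
  also have "(\<integral>z. exponential_density l z * g z \<partial>lborel) = expectation (\<lambda>\<omega>. g (X \<omega>))"
    by (rule distributed_integral[OF DX]) (auto simp: nonneg)
  also have "(\<integral>z. exponential_density k z * g z \<partial>lborel) = expectation (\<lambda>\<omega>. g (Y \<omega>))"
    by (rule distributed_integral[OF DY]) (auto simp: nonneg)
  finally show ?thesis .
qed

section \<open>Jensen's inequality for the source terms\<close>

lemma convex_on_ln_one_plus_exp: "convex_on UNIV (\<lambda>w::real. ln (1 + exp w))"
proof (rule convex_on_realI)
  \<comment> \<open>The derivative is the logistic function, so convexity reduces to its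
    monotonicity.\<close>
  show "((\<lambda>w. ln (1 + exp w)) has_real_derivative exp w / (1 + exp w)) (at w)" for w :: real
    by (auto intro!: derivative_eq_intros simp: add_pos_pos)
  show "exp x / (1 + exp x) \<le> exp y / (1 + exp y)" if "x \<le> y" for x y :: real
    using that by (simp add: divide_simps add_pos_pos add_nonneg_eq_0_iff algebra_simps)
qed simp

text \<open>Where \<open>S\<close> is positive, \<open>1 + S = 1 + exp (ln S)\<close>, so this is
  Jensen's inequality for the convex function above at the variable \<open>ln S\<close>.\<close>

lemma (in prob_space) expectation_ln_one_plus_ge:
  fixes S :: "'a \<Rightarrow> real"
  assumes "AE \<omega> in M. 0 < S \<omega>"
    and "integrable M (\<lambda>\<omega>. ln (S \<omega>))" "integrable M (\<lambda>\<omega>. ln (1 + S \<omega>))"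
  shows "ln (1 + exp (expectation (\<lambda>\<omega>. ln (S \<omega>)))) \<le> expectation (\<lambda>\<omega>. ln (1 + S \<omega>))"
proof -
  have [measurable]: "(\<lambda>\<omega>. ln (S \<omega>)) \<in> borel_measurable M"
    using assms(2) by auto
  have eq: "AE \<omega> in M. ln (1 + exp (ln (S \<omega>))) = ln (1 + S \<omega>)"
    using assms(1) by eventually_elim simp
  have "integrable M (\<lambda>\<omega>. ln (1 + exp (ln (S \<omega>))))"
    using assms(3) by (subst integrable_cong_AE[OF _ _ eq]) auto
  then have "ln (1 + exp (expectation (\<lambda>\<omega>. ln (S \<omega>)))) \<le> expectation (\<lambda>\<omega>. ln (1 + exp (ln (S \<omega>))))"
    using assms(2) convex_on_ln_one_plus_exp
    by (intro jensens_inequality[where q = "\<lambda>w. ln (1 + exp w)" and I = UNIV]) auto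
  also have "\<dots> = expectation (\<lambda>\<omega>. ln (1 + S \<omega>))"
    using assms(3) by (intro integral_cong_AE[OF _ _ eq]) auto
  finally show ?thesis .
qed

text \<open>\<open>l * X\<close> has rate 1, and \<open>ln X = ln (l * X) - ln l\<close> almost
  everywhere.\<close>

lemma (in prob_space) exponential_distributed_ln:
  assumes D: "distributed M lborel X (exponential_density l)" and "0 < l"
  shows "integrable M (\<lambda>\<omega>. ln (X \<omega>))"
    and "- ln l - euler_mascheroni \<le> expectation (\<lambda>\<omega>. ln (X \<omega>))"
proof -
  have [measurable]: "X \<in> borel_measurable M"
    using distributed_measurable[OF D] by simp
  have D1: "distributed M lborel (\<lambda>\<omega>. l * X \<omega>) (exponential_density 1)"
    using exponential_distributed_scale[OF D \<open>0 < l\<close> \<open>0 < l\<close>] \<open>0 < l\<close> by simp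
  have eq: "AE \<omega> in M. ln (X \<omega>) = ln (l * X \<omega>) - ln l"
    using exponential_distributed_AE_pos[OF D \<open>0 < l\<close>]
    by eventually_elim (use \<open>0 < l\<close> in \<open>simp add: ln_mult\<close>)
  have int: "integrable M (\<lambda>\<omega>. ln (l * X \<omega>))"
    by (rule exponential_distributed_integrable_ln[OF D1])
  then show "integrable M (\<lambda>\<omega>. ln (X \<omega>))"
    by (subst integrable_cong_AE[OF _ _ eq]) auto
  have "expectation (\<lambda>\<omega>. ln (X \<omega>)) = expectation (\<lambda>\<omega>. ln (l * X \<omega>) - ln l)"
    by (rule integral_cong_AE[OF _ _ eq]) auto
  also have "\<dots> = expectation (\<lambda>\<omega>. ln (l * X \<omega>)) - ln l"
    using int by (simp add: prob_space)
  finally show "- ln l - euler_mascheroni \<le> expectation (\<lambda>\<omega>. ln (X \<omega>))"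
    using exponential_distributed_expectation_ln_ge[OF D1] by simp
qed

section \<open>The source and relay terms of the bound\<close>

text \<open>The logarithm of the SNR splits into one-variable terms, so its mean follows from those
  of \<open>ln X\<close>, \<open>ln Y\<close> and \<open>ln (1 + Y / \<beta>)\<close>. Rates are
  kept general so that exchanging \<open>X\<close> and \<open>Y\<close> covers the other source as
  well.\<close>

lemma (in prob_space) expectation_ln_snr_S2_ge:
  assumes DX: "distributed M lborel X (exponential_density l)" and "0 < l"
    and DY: "distributed M lborel Y (exponential_density k)" and "0 < k"
    and "0 < P" "0 < N0" "0 < \<beta>"
  shows "integrable M (\<lambda>\<omega>. ln (1 + snr_S2 P N0 \<beta> (X \<omega>) (Y \<omega>)))" (is ?int)
    and "I_hat N0 \<beta> (P / l) (1 / k) \<le> expectation (\<lambda>\<omega>. ln (1 + snr_S2 P N0 \<beta> (X \<omega>) (Y \<omega>)))"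
proof -
  define S where "S \<omega> = snr_S2 P N0 \<beta> (X \<omega>) (Y \<omega>)" for \<omega>
  have [measurable]: "X \<in> borel_measurable M" "Y \<in> borel_measurable M"
    using distributed_measurable[OF DX] distributed_measurable[OF DY] by simp_all
  have [measurable]: "S \<in> borel_measurable M"
    unfolding S_def snr_S2_def by measurable
  have pos: "AE \<omega> in M. 0 < X \<omega> \<and> 0 < Y \<omega>"
    using exponential_distributed_AE_pos[OF DX \<open>0 < l\<close>] exponential_distributed_AE_pos[OF DY \<open>0 < k\<close>]
    by eventually_elim simp
  have S_pos: "AE \<omega> in M. 0 < S \<omega>"
    using pos by eventually_elim (use assms in \<open>simp add: S_def snr_S2_def add_pos_pos\<close>)
  have intS: "integrable M (\<lambda>\<omega>. ln (1 + S \<omega>))"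
  proof (rule Bochner_Integration.integrable_bound)
    show "integrable M (\<lambda>\<omega>. P / N0 * X \<omega>)"
      using exponential_distributed_integrable[OF DX \<open>0 < l\<close>] by simp
    show "AE \<omega> in M. norm (ln (1 + S \<omega>)) \<le> norm (P / N0 * X \<omega>)"
      using pos S_pos
    proof eventually_elim
      case (elim \<omega>)
      \<comment> \<open>The last factor is at most 1, which makes \<open>P / N0 * X\<close> an
        integrable dominating function.\<close>
      have "S \<omega> = P / N0 * X \<omega> * (Y \<omega> / (Y \<omega> + \<beta>))"
        using assms by (simp add: S_def snr_S2_def distrib_left[symmetric])
      also have "\<dots> \<le> P / N0 * X \<omega> * 1"
        using elim assms by (intro mult_left_mono) (auto simp: divide_simps)
      finally have "S \<omega> \<le> P / N0 * X \<omega>" by simp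
      moreover have "norm (ln (1 + S \<omega>)) \<le> norm (S \<omega>)"
        using elim by (intro norm_ln_one_plus_le) simp
      ultimately show ?case using elim by (simp only: real_norm_def)
    qed
  qed simp
  then show ?int by (simp add: S_def)
  \<comment> \<open>Taking \<open>\<beta>\<close> out of \<open>Y + \<beta>\<close> gives the last
    term the form required by \<open>exponential_distributed_ln_add\<close> with
    \<open>c = \<beta>\<close>.\<close>
  have eq: "AE \<omega> in M. ln (S \<omega>) =
      ln (P / (N0 * \<beta>)) + ln (X \<omega>) + ln (Y \<omega>) - ln (1 + Y \<omega> / \<beta>)"
    using pos
  proof eventually_elim
    case (elim \<omega>)
    have "S \<omega> = P / (N0 * \<beta>) * X \<omega> * Y \<omega> / (1 + Y \<omega> / \<beta>)"
      using elim assms by (simp add: S_def snr_S2_def field_simps)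
    moreover have "0 < 1 + Y \<omega> / \<beta>" "0 < P / (N0 * \<beta>)"
      using elim assms by (simp_all add: add_pos_pos)
    moreover have "ln (a * x * y / d) = ln a + ln x + ln y - ln d"
      if "0 < a" "0 < x" "0 < y" "0 < d" for a x y d :: real
      using that by (simp add: ln_mult ln_div)
    ultimately show ?case
      using elim by metis
  qed
  note lnX = exponential_distributed_ln[OF DX \<open>0 < l\<close>]
    and lnY = exponential_distributed_ln[OF DY \<open>0 < k\<close>]
    and lnY' = exponential_distributed_ln_add[OF DY \<open>0 < k\<close> \<open>0 < \<beta>\<close>]
  have int_lnS: "integrable M (\<lambda>\<omega>. ln (S \<omega>))"
    using lnX(1) lnY(1) lnY'(1) by (subst integrable_cong_AE[OF _ _ eq]) auto
  have "expectation (\<lambda>\<omega>. ln (S \<omega>)) =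
      expectation (\<lambda>\<omega>. ln (P / (N0 * \<beta>)) + ln (X \<omega>) + ln (Y \<omega>) - ln (1 + Y \<omega> / \<beta>))"
    by (rule integral_cong_AE[OF _ _ eq]) auto
  also have "\<dots> = ln (P / (N0 * \<beta>)) + expectation (\<lambda>\<omega>. ln (X \<omega>)) + expectation (\<lambda>\<omega>. ln (Y \<omega>))
      + exp (\<beta> * k) * Ei (- (\<beta> * k))"
    using lnX(1) lnY(1) lnY' by (simp add: prob_space)
  \<comment> \<open>\<open>ln X\<close> and \<open>ln Y\<close> each contribute one
    \<open>- euler_mascheroni\<close>.\<close>
  also have "\<dots> \<ge> - 2 * euler_mascheroni + (ln (P / (N0 * \<beta>)) - ln l - ln k)
      + exp (\<beta> * k) * Ei (- (\<beta> * k))"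
    using lnX(2) lnY(2) by simp
  also have "ln (P / (N0 * \<beta>)) - ln l - ln k = ln (P / l * (1 / k) / (\<beta> * N0))"
    using assms by (simp add: ln_mult ln_div)
  finally have "ln (1 + exp (- 2 * euler_mascheroni + ln (P / l * (1 / k) / (\<beta> * N0))
      + exp (\<beta> * k) * Ei (- (\<beta> * k)))) \<le> ln (1 + exp (expectation (\<lambda>\<omega>. ln (S \<omega>))))"
    by (simp add: add_pos_pos)
  also have "\<dots> \<le> expectation (\<lambda>\<omega>. ln (1 + S \<omega>))"
    by (rule expectation_ln_one_plus_ge[OF S_pos int_lnS intS])
  finally show "I_hat N0 \<beta> (P / l) (1 / k) \<le> expectation (\<lambda>\<omega>. ln (1 + snr_S2 P N0 \<beta> (X \<omega>) (Y \<omega>)))"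
    by (simp add: I_hat_def S_def)
qed

text \<open>\<open>P1 * X\<close> and \<open>P2 * Y\<close> are independent exponentials with the
  distinct means \<open>a\<close> and \<open>b\<close>, so the mean for their sum combines two
  values of \<open>exponential_distributed_ln_add\<close> with \<open>c = N0\<close>.\<close>

lemma (in prob_space) expectation_ln_snr_R:
  assumes DX: "distributed M lborel X (exponential_density (1 / \<mu>1))" and "0 < \<mu>1"
    and DY: "distributed M lborel Y (exponential_density (1 / \<mu>2))" and "0 < \<mu>2"
    and "0 < P1" "0 < P2" "0 < N0" and indep: "indep_var borel X borel Y"
    and ne: "P1 * \<mu>1 \<noteq> P2 * \<mu>2"
  shows "integrable M (\<lambda>\<omega>. ln (1 + snr_R P1 P2 N0 (X \<omega>) (Y \<omega>)))" (is ?int)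
    and "expectation (\<lambda>\<omega>. ln (1 + snr_R P1 P2 N0 (X \<omega>) (Y \<omega>))) = I_3 N0 (P1 * \<mu>1) (P2 * \<mu>2)"
proof -
  define a b where "a = P1 * \<mu>1" and "b = P2 * \<mu>2"
  have ab: "0 < a" "0 < b" "a \<noteq> b"
    using assms by (simp_all add: a_def b_def)
  define U V where "U = (\<lambda>\<omega>. P1 * X \<omega>)" and "V = (\<lambda>\<omega>. P2 * Y \<omega>)"
  have DU: "distributed M lborel U (exponential_density (1 / a))"
    using exponential_distributed_scale[OF DX _ \<open>0 < P1\<close>] assms by (simp add: U_def a_def mult_ac)
  have DV: "distributed M lborel V (exponential_density (1 / b))"
    using exponential_distributed_scale[OF DY _ \<open>0 < P2\<close>] assms by (simp add: V_def b_def mult_ac)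
  have [measurable]: "U \<in> borel_measurable M" "V \<in> borel_measurable M"
    using distributed_measurable[OF DU] distributed_measurable[OF DV] by simp_all
  have "indep_var borel ((*) P1 \<circ> X) borel ((*) P2 \<circ> Y)"
    by (rule indep_var_compose[OF indep]) auto
  then have indep': "indep_var borel U borel V"
    by (simp add: U_def V_def o_def)
  have R: "snr_R P1 P2 N0 (X \<omega>) (Y \<omega>) = (U \<omega> + V \<omega>) / N0" for \<omega>
    by (simp add: snr_R_def U_def V_def)
  note lnU = exponential_distributed_ln_add[OF DU _ \<open>0 < N0\<close>]
    and lnV = exponential_distributed_ln_add[OF DV _ \<open>0 < N0\<close>]
  have "AE \<omega> in M. 0 < U \<omega>" "AE \<omega> in M. 0 < V \<omega>"
    using exponential_distributed_AE_pos[OF DU] exponential_distributed_AE_pos[OF DV] ab by simp_all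
  then have pos: "AE \<omega> in M. 0 < (U \<omega> + V \<omega>) / N0"
    by eventually_elim (use \<open>0 < N0\<close> in simp)
  have "integrable M (\<lambda>\<omega>. ln (1 + (U \<omega> + V \<omega>) / N0))"
  proof (rule Bochner_Integration.integrable_bound)
    show "integrable M (\<lambda>\<omega>. (U \<omega> + V \<omega>) / N0)"
      using exponential_distributed_integrable[OF DU] exponential_distributed_integrable[OF DV] ab
      by simp
    show "AE \<omega> in M. norm (ln (1 + (U \<omega> + V \<omega>) / N0)) \<le> norm ((U \<omega> + V \<omega>) / N0)"
      using pos by eventually_elim (rule norm_ln_one_plus_le)
  qed simp
  then show ?int by (simp add: R)
  have "expectation (\<lambda>\<omega>. ln (1 + (U \<omega> + V \<omega>) / N0)) =
      (1 / b * expectation (\<lambda>\<omega>. ln (1 + U \<omega> / N0)) - 1 / a * expectation (\<lambda>\<omega>. ln (1 + V \<omega> / N0)))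
      / (1 / b - 1 / a)"
    using exponential_distributed_sum_expectation[OF DU _ DV _ _ indep', of "\<lambda>z. ln (1 + z / N0)"]
      lnU(1) lnV(1) ab by simp
  \<comment> \<open>Numerator and denominator are multiplied by \<open>a * b\<close> to pass from
    rates to means.\<close>
  also have "\<dots> = (a * expectation (\<lambda>\<omega>. ln (1 + U \<omega> / N0))
      - b * expectation (\<lambda>\<omega>. ln (1 + V \<omega> / N0))) / (a - b)"
    using ab by (simp add: divide_simps)
  also have "\<dots> = I_3 N0 a b"
  proof -
    \<comment> \<open>The minus sign on the left comes from the one in front of
      \<open>exp (c * l) * Ei (- (c * l))\<close> in each one-variable mean.\<close>
    have "- (a * u - b * v) / (a - b) = a / (b - a) * u + b / (a - b) * v" for u v
      using ab by (simp add: divide_simps) (simp add: algebra_simps)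
    from this[of "exp (N0 / a) * Ei (- N0 / a)" "exp (N0 / b) * Ei (- N0 / b)"] show ?thesis
      using lnU(2) lnV(2) ab by (simp add: I_3_def mult.assoc)
  qed
  finally show "expectation (\<lambda>\<omega>. ln (1 + snr_R P1 P2 N0 (X \<omega>) (Y \<omega>))) = I_3 N0 (P1 * \<mu>1) (P2 * \<mu>2)"
    by (simp add: R a_def b_def)
qed

section \<open>Combining the three terms under the positive part\<close>

theorem mainTheorem2:
  fixes M :: "'a measure" and X Y :: "'a \<Rightarrow> real"
    and \<alpha> \<eta> \<beta> P1 P2 N0 \<mu>1 \<mu>2 \<gamma>1 \<gamma>2 :: real
  assumes "0 < \<alpha>" and "\<alpha> < 1" and "0 < \<eta>" and "\<eta> < 1"
    and "\<beta> = (1 - \<alpha>) / (2 * \<eta> * \<alpha>)"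
    and "0 < P1" and "0 < P2" and "0 < N0" and "0 < \<mu>1" and "0 < \<mu>2"
    and "prob_space M"
    and "distributed M lborel X (\<lambda>x. ennreal (exponential_density (1 / \<mu>1) x))"
    and "distributed M lborel Y (\<lambda>y. ennreal (exponential_density (1 / \<mu>2) y))"
    and "prob_space.indep_var M borel X borel Y"
    and "\<gamma>1 = P1 * \<mu>1" and "\<gamma>2 = P2 * \<mu>2" and "\<gamma>1 \<noteq> \<gamma>2"
  shows "R_Act_WoJ M X Y \<alpha> \<beta> P1 P2 N0 \<ge> R_LB_WoJ \<alpha> \<beta> N0 \<mu>1 \<mu>2 \<gamma>1 \<gamma>2"
proof -
  interpret prob_space M by fact
  note DX = assms(12) and DY = assms(13)
  have "0 < \<beta>" using assms(1-5) by simp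
  have l: "0 < 1 / \<mu>1" "0 < 1 / \<mu>2" using assms by simp_all
  define S1 S2 R where "S1 \<omega> = snr_S1 P2 N0 \<beta> (X \<omega>) (Y \<omega>)"
    and "S2 \<omega> = snr_S2 P1 N0 \<beta> (X \<omega>) (Y \<omega>)"
    and "R \<omega> = snr_R P1 P2 N0 (X \<omega>) (Y \<omega>)" for \<omega>
  \<comment> \<open>Source 1 is source 2 with the two gains exchanged, so a single lemma bounds
    both.\<close>
  have S1_eq: "S1 \<omega> = snr_S2 P2 N0 \<beta> (Y \<omega>) (X \<omega>)" for \<omega>
    by (simp add: S1_def snr_S1_def snr_S2_def mult_ac)
  have [measurable]: "X \<in> borel_measurable M" "Y \<in> borel_measurable M"
    using distributed_measurable[OF DX] distributed_measurable[OF DY] by simp_all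
  have [measurable]: "S1 \<in> borel_measurable M" "S2 \<in> borel_measurable M" "R \<in> borel_measurable M"
    unfolding S1_def S2_def R_def snr_S1_def snr_S2_def snr_R_def by measurable
  have S2: "integrable M (\<lambda>\<omega>. ln (1 + S2 \<omega>))"
      "I_hat N0 \<beta> \<gamma>1 \<mu>2 \<le> expectation (\<lambda>\<omega>. ln (1 + S2 \<omega>))"
    using expectation_ln_snr_S2_ge[OF DX l(1) DY l(2) \<open>0 < P1\<close> \<open>0 < N0\<close> \<open>0 < \<beta>\<close>] assms(15)
    by (simp_all add: S2_def)
  have S1: "integrable M (\<lambda>\<omega>. ln (1 + S1 \<omega>))"
      "I_hat N0 \<beta> \<gamma>2 \<mu>1 \<le> expectation (\<lambda>\<omega>. ln (1 + S1 \<omega>))"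
    using expectation_ln_snr_S2_ge[OF DY l(2) DX l(1) \<open>0 < P2\<close> \<open>0 < N0\<close> \<open>0 < \<beta>\<close>] assms(16)
    by (simp_all add: S1_eq)
  have R: "integrable M (\<lambda>\<omega>. ln (1 + R \<omega>))"
      "expectation (\<lambda>\<omega>. ln (1 + R \<omega>)) = I_3 N0 \<gamma>1 \<gamma>2"
    using expectation_ln_snr_R[OF DX \<open>0 < \<mu>1\<close> DY \<open>0 < \<mu>2\<close> \<open>0 < P1\<close> \<open>0 < P2\<close> \<open>0 < N0\<close>] assms(14-17)
    by (simp_all add: R_def)
  \<comment> \<open>The factor \<open>1 / ln 2\<close> converts \<open>log 2\<close> to
    \<open>ln\<close>; being nonnegative, \<open>c\<close> can be pulled out of the positive
    part.\<close>
  define c where "c = (1 - \<alpha>) / (2 * ln 2)"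
  have "0 \<le> c" using assms(2) by (simp add: c_def)
  define Z where "Z \<omega> = ln (1 + S2 \<omega>) + ln (1 + S1 \<omega>) - ln (1 + R \<omega>)" for \<omega>
  have [measurable]: "Z \<in> borel_measurable M" unfolding Z_def by measurable
  have intZ: "integrable M Z"
    unfolding Z_def using S1 S2 R by simp
  have EZ: "I_hat N0 \<beta> \<gamma>1 \<mu>2 + I_hat N0 \<beta> \<gamma>2 \<mu>1 - I_3 N0 \<gamma>1 \<gamma>2 \<le> expectation Z"
    unfolding Z_def using S1 S2 R by simp
  have eq: "AE \<omega> in M. pos_part ((1 - \<alpha>) / 2 * log 2 ((1 + S1 \<omega>) * (1 + S2 \<omega>) / (1 + R \<omega>)))
      = c * max (Z \<omega>) 0"
    using exponential_distributed_AE_pos[OF DX l(1)] exponential_distributed_AE_pos[OF DY l(2)]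
  proof eventually_elim
    case (elim \<omega>)
    have "0 < 1 + S1 \<omega>" "0 < 1 + S2 \<omega>" "0 < 1 + R \<omega>"
      using elim assms(6-8) \<open>0 < \<beta>\<close>
      by (simp_all add: S1_def S2_def R_def snr_S1_def snr_S2_def snr_R_def add_pos_pos)
    then have "(1 - \<alpha>) / 2 * log 2 ((1 + S1 \<omega>) * (1 + S2 \<omega>) / (1 + R \<omega>)) = c * Z \<omega>"
      by (simp add: log_def c_def Z_def ln_mult ln_div)
    then show ?case
      using \<open>0 \<le> c\<close> by (simp add: pos_part_def max_mult_distrib_left)
  qed
  have "R_LB_WoJ \<alpha> \<beta> N0 \<mu>1 \<mu>2 \<gamma>1 \<gamma>2 \<le> c * max (expectation Z) 0"
    unfolding R_LB_WoJ_def c_def[symmetric] pos_part_def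
    using EZ \<open>0 \<le> c\<close> by (intro mult_left_mono) auto
  \<comment> \<open>For the positive part, Jensen's inequality amounts to comparing
    \<open>max Z 0\<close> with \<open>Z\<close> and with 0.\<close>
  also have "max (expectation Z) 0 \<le> expectation (\<lambda>\<omega>. max (Z \<omega>) 0)"
    using intZ by (auto intro!: integral_mono integral_nonneg_AE)
  also have "c * expectation (\<lambda>\<omega>. max (Z \<omega>) 0) = expectation (\<lambda>\<omega>. c * max (Z \<omega>) 0)"
    by simp
  also have "\<dots> = R_Act_WoJ M X Y \<alpha> \<beta> P1 P2 N0"
    unfolding R_Act_WoJ_def S1_def[symmetric] S2_def[symmetric] R_def[symmetric]
    by (rule integral_cong_AE[OF _ _ eq, symmetric]) (auto simp: pos_part_def)
  \<comment> \<open>Rewriting below the factor \<open>c\<close> leaves a monotonicity premise,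
    settled by \<open>0 \<le> c\<close>.\<close>
  finally show ?thesis
    using \<open>0 \<le> c\<close> by (simp add: mult_left_mono)
qed

end
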